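(* Let $\tilde f\in L^2(\frac{dp}{2p},\mathbb R_+)$ and $\tilde g\in L^2(\frac{dk}{2k},\mathbb R_+)$ be two normalized wave functions such that $f(y)$ and $g(x)$ exist almost everywhere and are integrable. Then for any transformation of coordinates $x(y)$, $$\bar N_o[f]\le\bar N_g[f]\le1+3\,\bar N_o[f],$$ $$1+\bar N_o[f]\le\bar N_{g_{cl}}[f],$$ where $g_{cl}$ is the classical incoming function given by $\tilde g_{cl}(k)=\|A\tilde f\|^{-1}(A\tilde f)(k)$.
   Context: A wave function $\tilde f\in L^2(\frac{dp}{2p},\mathbb R_+)$ is extended by $0$ to $p<0$ and $f(y)=\frac1{\sqrt{2\pi}}\int_0^\infty\tilde f(p)e^{ipy}\,dp$ (so $\tilde f(p)=\frac1{\sqrt{2\pi}}\int f(y)e^{-ipy}dy$); similarly for $g$. Normalized means $\int_0^\infty\frac{dp}{2p}|\tilde f(p)|^2=1$. $\langle u,v\rangle=\int_0^\infty\frac{dk}{2k}u(k)^*v(k)$ and $\|u\|^2=\langle u,u\rangle$. A transformation of coordinates is a smooth map $y\mapsto x(y)$, $\mathbb R\to\mathbb R$, with $x'(y)>0$. $(U\tilde f)(k)=\frac1{\sqrt{2\pi}}\int_{-\infty}^\infty e^{-ikx(y)}f(y)\,dy$ for $k\in\mathbb R$; $(A\tilde f)(k)=(U\tilde f)(k)$ and $(B\tilde f)(k)=(U\tilde f)(-k)$ for $k>0$. The mean number of spontaneously created particles is $\bar N_o[f]=\int_0^\infty\frac{dk}{2k}|(U\tilde f)(-k)|^2=\|B\tilde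 f\|^2\in[0,\infty]$. The mean number of particles stimulated by the incoming one-particle state with wave function $g$ is $$\bar N_g[f]=\bar N_o[f]+|\langle\tilde g,A\tilde f\rangle|^2+|\langle\tilde g^*,B\tilde f\rangle|^2$$ (for Schwartz test functions this is the expectation $(\Omega_g,\hat\phi[f]^\dagger\hat\phi[f]\Omega_g)$ of the massless scalar field in the state $\Omega_g=\phi[g]^\dagger\Omega_o$, with $\hat\phi(y)=\phi(x(y))$; it is extended by continuity to wave functions as in the claim). The function $g_{cl}$ is defined when $\|A\tilde f\|<\infty$. *)

theory Defs
  imports "HOL-Analysis.Analysis"
begin

text \<open>
  The space \<open>L\<^sup>2(dp/2p, \<real>\<^sub>+)\<close> is represented by functions \<open>real \<Rightarrow> complex\<close> that are
  measurable on the positive half-line; their values at \<open>p \<le> 0\<close> are never used.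
\<close>

definition mom :: "real measure" where
  "mom = density (restrict_space lborel {0<..}) (\<lambda>p. ennreal (1 / (2 * p)))"

definition sqnorm :: "(real \<Rightarrow> complex) \<Rightarrow> ennreal" where
  "sqnorm u = (\<integral>\<^sup>+ k. ennreal ((cmod (u k))\<^sup>2) \<partial>mom)"

definition L2norm :: "(real \<Rightarrow> complex) \<Rightarrow> real" where
  "L2norm u = sqrt (enn2real (sqnorm u))"

definition inner_mom :: "(real \<Rightarrow> complex) \<Rightarrow> (real \<Rightarrow> complex) \<Rightarrow> complex" where
  "inner_mom u v = (LINT k|mom. cnj (u k) * v k)"

definition L2_mom :: "(real \<Rightarrow> complex) set" where
  "L2_mom = {u. u \<in> borel_measurable mom \<and> sqnorm u < \<infinity>}"

definition normalized :: "(real \<Rightarrow> complex) \<Rightarrow> bool" where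
  "normalized u \<longleftrightarrow> sqnorm u = 1"

definition ext0 :: "(real \<Rightarrow> complex) \<Rightarrow> real \<Rightarrow> complex" where
  "ext0 u p = (if p > 0 then u p else 0)"

text \<open>
  For \<open>u \<in> L\<^sup>2(dp/2p, \<real>\<^sub>+)\<close> the function \<open>u\<close> is integrable on every \<open>(0, R]\<close> (Cauchy-Schwarz)
  but not necessarily on \<open>(0, \<infinity>)\<close>, so the integral defining the position space function is
  taken as the improper integral \<open>R \<rightarrow> \<infinity>\<close>, which may exist for almost every \<open>y\<close> only.
\<close>

definition pos_partial :: "(real \<Rightarrow> complex) \<Rightarrow> real \<Rightarrow> real \<Rightarrow> complex" where
  "pos_partial u y R = complex_of_real (1 / sqrt (2 * pi)) *
     (LINT p:{0<..R}|lborel. u p * exp (\<i> * complex_of_real (p * y)))"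

definition pos_exists :: "(real \<Rightarrow> complex) \<Rightarrow> real \<Rightarrow> bool" where
  "pos_exists u y \<longleftrightarrow> (\<exists>l. (pos_partial u y \<longlongrightarrow> l) at_top)"

definition pos_fun :: "(real \<Rightarrow> complex) \<Rightarrow> real \<Rightarrow> complex" where
  "pos_fun u y = Lim at_top (pos_partial u y)"

definition fourier :: "(real \<Rightarrow> complex) \<Rightarrow> real \<Rightarrow> complex" where
  "fourier f p = complex_of_real (1 / sqrt (2 * pi)) *
     (LINT y|lborel. f y * exp (- \<i> * complex_of_real (p * y)))"

text \<open>
  The wave function and its position space function form a Fourier pair: the function
  exists almost everywhere, is integrable, and the inverse relation holds.  The last
  conjunct is the Fourier inversion theorem when \<open>u\<close> is integrable on \<open>(0, \<infinity>)\<close>.  It has to be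
  part of the notion because almost everywhere convergence of an improper Fourier integral
  to an integrable function is not by itself a justification for inverting it.
\<close>

definition has_integrable_pos_fun :: "(real \<Rightarrow> complex) \<Rightarrow> bool" where
  "has_integrable_pos_fun u \<longleftrightarrow>
     (AE y in lborel. pos_exists u y) \<and>
     integrable lborel (pos_fun u) \<and>
     (AE p in lborel. ext0 u p = fourier (pos_fun u) p)"

text \<open>\<open>x\<close> is not required to be surjective.\<close>

definition coord_transformation :: "(real \<Rightarrow> real) \<Rightarrow> bool" where
  "coord_transformation x \<longleftrightarrow>
     (\<forall>n y. ((deriv ^^ n) x) field_differentiable (at y)) \<and> (\<forall>y. deriv x y > 0)"

definition U_op :: "(real \<Rightarrow> real) \<Rightarrow> (real \<Rightarrow> complex) \<Rightarrow> real \<Rightarrow> complex" where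
  "U_op x u k = complex_of_real (1 / sqrt (2 * pi)) *
     (LINT y|lborel. exp (- \<i> * complex_of_real (k * x y)) * pos_fun u y)"

text \<open>\<open>A_op x u\<close> and \<open>B_op x u\<close> are meant as functions on the positive half-line.\<close>

definition A_op :: "(real \<Rightarrow> real) \<Rightarrow> (real \<Rightarrow> complex) \<Rightarrow> real \<Rightarrow> complex" where
  "A_op x u k = U_op x u k"

definition B_op :: "(real \<Rightarrow> real) \<Rightarrow> (real \<Rightarrow> complex) \<Rightarrow> real \<Rightarrow> complex" where
  "B_op x u k = U_op x u (- k)"

definition N_spont :: "(real \<Rightarrow> real) \<Rightarrow> (real \<Rightarrow> complex) \<Rightarrow> ennreal" where
  "N_spont x u = sqnorm (B_op x u)"

text \<open>
  If \<open>B_op x u\<close> is not square integrable, the Bochner integrals in the last two terms may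
  be meaningless (and are then \<open>0\<close>), but the sum is \<open>\<infinity>\<close> because of its first term.
\<close>

definition N_stim :: "(real \<Rightarrow> real) \<Rightarrow> (real \<Rightarrow> complex) \<Rightarrow> (real \<Rightarrow> complex) \<Rightarrow> ennreal" where
  "N_stim x v u = N_spont x u
     + ennreal ((cmod (inner_mom v (A_op x u)))\<^sup>2)
     + ennreal ((cmod (inner_mom (\<lambda>k. cnj (v k)) (B_op x u)))\<^sup>2)"

definition g_cl :: "(real \<Rightarrow> real) \<Rightarrow> (real \<Rightarrow> complex) \<Rightarrow> real \<Rightarrow> complex" where
  "g_cl x u k = complex_of_real (inverse (L2norm (A_op x u))) * A_op x u k"

end

theory Submission
  imports Defs "HOL-Probability.Sinc_Integral" "HOL-Real_Asymp.Real_Asymp"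
begin

text \<open>
  Everything rests on \<open>\<parallel>A f\<parallel>\<^sup>2 = 1 + \<parallel>B f\<parallel>\<^sup>2\<close>; the estimates then follow from the
  Cauchy-Schwarz inequality.  By Fubini,
  \<open>\<bar>U f (k)\<bar>\<^sup>2 - \<bar>U f (-k)\<bar>\<^sup>2\<close> is the integral of
  \<open>- \<i> / \<pi> * sin (k (x(y) - x(z))) f(y) f(z)\<^sup>*\<close> over \<open>y\<close> and \<open>z\<close>.
  Integrated against \<open>dk/2k\<close> over \<open>(1/n, n)\<close>, the sine becomes a
  difference of sine integrals, which is bounded and tends to \<open>\<pi>/4 * sgn (x(y) - x(z))\<close>.
  Since \<open>x\<close> is increasing, the limit \<open>\<parallel>A f\<parallel>\<^sup>2 - \<parallel>B f\<parallel>\<^sup>2\<close> does not depend on \<open>x\<close>, and for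
  \<open>x(y) = y\<close> it equals \<open>1\<close> by Fourier inversion.
\<close>

section \<open>Truncations of the measure dk/2k\<close>

text \<open>dk/2k has infinite mass near 0 and near infinity; with both ends cut off it is finite,
  so Fubini applies to bounded oscillating factors. \<open>Suc n\<close> avoids division by 0, and
  the band of index 0 is empty. A density on all of \<open>lborel\<close> keeps ordinary Borel
  measurability usable.\<close>

definition band :: "nat \<Rightarrow> real measure" where
  "band n = density lborel
     (\<lambda>k. ennreal (indicator {1 / real (Suc n)<..<real (Suc n)} k * (1 / (2 * k))))"

lemma sets_band [measurable_cong, simp]: "sets (band n) = sets borel"
  by (simp add: band_def)

lemma space_band [simp]: "space (band n) = UNIV"
  by (simp add: band_def)

lemma band_pos: "1 / real (Suc n) < k \<Longrightarrow> 0 < k"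
  by (meson less_trans of_nat_0_less_iff zero_less_Suc zero_less_divide_1_iff)

lemma band_density_nonneg:
  "0 \<le> indicator {1 / real (Suc n)<..<real (Suc n)} k * (1 / (2 * k :: real))"
  using band_pos[of n k] by (auto simp: indicator_def simp del: of_nat_Suc)

lemma integral_band:
  fixes g :: "real \<Rightarrow> 'b::{banach, second_countable_topology}"
  assumes [measurable]: "g \<in> borel_measurable borel"
  shows "(LINT k|band n. g k)
    = (LINT k|lborel. (indicator {1 / real (Suc n)<..<real (Suc n)} k * (1 / (2 * k))) *\<^sub>R g k)"
  unfolding band_def
  using band_density_nonneg[of n] by (subst integral_density) auto

lemma nn_integral_band:
  assumes [measurable]: "g \<in> borel_measurable borel"
  shows "(\<integral>\<^sup>+ k. g k \<partial>band n)
    = (\<integral>\<^sup>+ k. ennreal (indicator {1 / real (Suc n)<..<real (Suc n)} k * (1 / (2 * k))) * g k \<partial>lborel)"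
  unfolding band_def by (subst nn_integral_density) auto

lemma finite_measure_band: "finite_measure (band n)"
proof
  let ?a = "1 / real (Suc n)" and ?b = "real (Suc n)"
  have "emeasure (band n) UNIV = (\<integral>\<^sup>+ k. 1 \<partial>band n)" by simp
  also have "\<dots> = (\<integral>\<^sup>+ k. ennreal (indicator {?a<..<?b} k * (1 / (2 * k))) * 1 \<partial>lborel)"
    by (rule nn_integral_band) simp
  also have "\<dots> \<le> (\<integral>\<^sup>+ k. ennreal ?b * indicator {?a<..<?b} k \<partial>lborel)"
  proof (rule nn_integral_mono)
    fix k :: real
    have "1 / (2 * k) \<le> ?b" if k: "?a < k"
    proof -
      have "k > 0" using k by (rule band_pos)
      moreover have "1 < k * ?b" using k by (simp add: divide_less_eq)
      ultimately show ?thesis by (simp add: divide_le_eq algebra_simps)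
    qed
    then show "ennreal (indicator {?a<..<?b} k * (1 / (2 * k))) * 1 \<le> ennreal ?b * indicator {?a<..<?b} k"
      by (auto simp: indicator_def simp del: of_nat_Suc intro!: ennreal_leI)
  qed
  also have "\<dots> = ennreal ?b * emeasure lborel {?a<..<?b}"
    by (simp add: nn_integral_cmult)
  also have "\<dots> < \<infinity>"
    by (cases "?a \<le> ?b") (auto simp: ennreal_mult_less_top)
  finally show "emeasure (band n) (space (band n)) \<noteq> \<infinity>"
    by simp
qed

lemma nn_integral_mom:
  assumes [measurable]: "g \<in> borel_measurable borel"
  shows "(\<integral>\<^sup>+ k. g k \<partial>mom)
    = (\<integral>\<^sup>+ k. ennreal (indicator {0<..} k * (1 / (2 * k))) * g k \<partial>lborel)"
proof -
  have "(\<integral>\<^sup>+ k. g k \<partial>mom) = (\<integral>\<^sup>+ k. ennreal (1 / (2 * k)) * g k \<partial>restrict_space lborel {0<..})"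
    unfolding mom_def
    by (rule nn_integral_density) (auto intro!: measurable_restrict_space1)
  also have "\<dots> = (\<integral>\<^sup>+ k. ennreal (1 / (2 * k)) * g k * indicator {0<..} k \<partial>lborel)"
    by (subst nn_integral_restrict_space) auto
  also have "\<dots> = (\<integral>\<^sup>+ k. ennreal (indicator {0<..} k * (1 / (2 * k))) * g k \<partial>lborel)"
    by (intro nn_integral_cong) (auto simp: indicator_def)
  finally show ?thesis .
qed

lemma AE_momI:
  assumes "AE k in lborel. k > 0 \<longrightarrow> P k"
  shows "AE k in mom. P k"
proof -
  have "AE k in restrict_space lborel {0<..}. P k"
    using assms by (subst AE_restrict_space_iff) auto
  then show ?thesis
    unfolding mom_def by (subst AE_density) (auto intro!: measurable_restrict_space1)
qed

text \<open>Monotone convergence: the bands increase to the positive half-line. The limit may be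
  infinite, which is needed because creation of infinitely many particles is allowed.\<close>

lemma nn_integral_band_tendsto:
  assumes [measurable]: "g \<in> borel_measurable borel"
  shows "(\<lambda>n. \<integral>\<^sup>+ k. g k \<partial>band n) \<longlonglongrightarrow> (\<integral>\<^sup>+ k. g k \<partial>mom)"
proof -
  let ?w = "\<lambda>n k. ennreal (indicator {1 / real (Suc n)<..<real (Suc n)} k * (1 / (2 * k))) * g k"
  have sub: "{1 / real (Suc m)<..<real (Suc m)} \<subseteq> {1 / real (Suc n)<..<real (Suc n)}" if "m \<le> n" for m n
  proof -
    have "1 / real (Suc n) \<le> 1 / real (Suc m)" using that by (intro divide_left_mono) auto
    then show ?thesis using that by (auto intro: order.strict_trans2 order.strict_trans1)
  qed
  have "mono (\<lambda>n. ?w n k)" for k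
  proof (rule monoI)
    fix m n :: nat assume "m \<le> n"
    then have "indicator {1 / real (Suc m)<..<real (Suc m)} k * (1 / (2 * k))
        \<le> indicator {1 / real (Suc n)<..<real (Suc n)} k * (1 / (2 * k))"
      using sub[of m n] band_density_nonneg[of n k]
      by (cases "k \<in> {1 / real (Suc m)<..<real (Suc m)}") (auto simp del: of_nat_Suc)
    then show "?w m k \<le> ?w n k"
      by (rule mult_right_mono[OF ennreal_leI]) simp
  qed
  then have mono: "incseq (\<lambda>n k. ?w n k)"
    by (auto simp: mono_def le_fun_def)
  have lim: "(\<lambda>n. ?w n k) \<longlonglongrightarrow> ennreal (indicator {0<..} k * (1 / (2 * k))) * g k" for k
  proof (rule tendsto_eventually)
    show "\<forall>\<^sub>F n in sequentially. ?w n k = ennreal (indicator {0<..} k * (1 / (2 * k))) * g k"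
    proof (cases "k > 0")
      case True
      have "\<forall>\<^sub>F n in sequentially. k < real (Suc n)" "\<forall>\<^sub>F n in sequentially. 1 / real (Suc n) < k"
        using True by real_asymp+
      then show ?thesis by eventually_elim (use True in auto)
    next
      case False
      have "\<not> 1 / real (Suc n) < k" for n
        using False band_pos by blast
      then show ?thesis using False by auto
    qed
  qed
  have "(\<lambda>n. \<integral>\<^sup>+ k. ?w n k \<partial>lborel)
      \<longlonglongrightarrow> (\<integral>\<^sup>+ k. ennreal (indicator {0<..} k * (1 / (2 * k))) * g k \<partial>lborel)"
    by (rule nn_integral_LIMSEQ[OF mono _ lim]) measurable
  then show ?thesis
    by (simp only: nn_integral_band[OF assms] nn_integral_mom[OF assms])
qed

section \<open>Sine integrals over the bands\<close>

text \<open>Rescaling by \<open>\<bar>a\<bar>\<close> turns the integral of sin(ka)/k over (0, T)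
  into \<open>Si (T * \<bar>a\<bar>)\<close>, and oddness in \<open>a\<close> gives the sign. The
  final 1/2 comes from the density 1/(2k).\<close>

lemma integral_band_sin:
  "(LINT k|band n. sin (k * a))
    = sgn a * (Si (real (Suc n) * \<bar>a\<bar>) - Si (1 / real (Suc n) * \<bar>a\<bar>)) / 2"
proof -
  let ?a = "1 / real (Suc n)" and ?b = "real (Suc n)"
  have ab: "?a \<le> ?b"
    by (simp add: divide_le_eq algebra_simps)
  have "(LINT k|band n. sin (k * a))
      = (LINT k|lborel. (1/2) * (indicator {?a<..<?b} k *\<^sub>R (sin (k * a) / k)))"
    by (subst integral_band) (auto intro!: Bochner_Integration.integral_cong simp: indicator_def)
  also have "\<dots> = (1/2) * (LBINT k=?a..?b. sin (k * a) / k)"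
    using ab by (simp only: integral_mult_right_zero interval_lebesgue_integral_def
        set_lebesgue_integral_def einterval_eq ereal_less_eq if_True)
  also have "(LBINT k=?a..?b. sin (k * a) / k)
      = (LBINT k=0..?b. sin (k * a) / k) - (LBINT k=0..?a. sin (k * a) / k)"
  proof -
    \<comment> \<open>Splitting at 0 requires integrability down to 0, where the integrand stays
      bounded.\<close>
    have "interval_lebesgue_integrable lborel (min (ereal 0) (min (ereal ?a) (ereal ?b)))
        (max (ereal 0) (max (ereal ?a) (ereal ?b))) (\<lambda>k. sin (k * a) / k)"
      using integrable_sinc'[of ?b a] ab by (simp add: min_def max_def zero_ereal_def[symmetric])
    from interval_integral_sum[OF this] show ?thesis by (simp add: zero_ereal_def)
  qed
  finally show ?thesis
    by (simp add: LBINT_I0c_sin_scale_divide algebra_simps)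
qed

text \<open>\<open>Si\<close> is bounded on the whole line, so one constant serves all
  \<open>n\<close> and \<open>a\<close>. This uniformity supplies the dominating function for the
  limit under the double integral.\<close>

lemma integral_band_sin_bounded: "\<exists>C. \<forall>n a. \<bar>LINT k|band n. sin (k * a)\<bar> \<le> C"
proof -
  obtain C where C: "\<And>T. \<bar>Si T\<bar> \<le> C" using bounded_Si by blast
  have "\<bar>LINT k|band n. sin (k * a)\<bar> \<le> C" for n a
  proof -
    have "\<bar>LINT k|band n. sin (k * a)\<bar>
        \<le> \<bar>Si (real (Suc n) * \<bar>a\<bar>) - Si (1 / real (Suc n) * \<bar>a\<bar>)\<bar> / 2"
      unfolding integral_band_sin by (cases "a = 0") (simp_all add: abs_mult abs_sgn_eq)
    also have "\<dots> \<le> C"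
    proof -
      have "\<bar>s - t\<bar> / 2 \<le> C" if "\<bar>s\<bar> \<le> C" "\<bar>t\<bar> \<le> C" for s t :: real
        using that abs_triangle_ineq4[of s t] by auto
      then show ?thesis using C by blast
    qed
    finally show ?thesis .
  qed
  then show ?thesis by blast
qed

text \<open>For nonzero \<open>a\<close> the upper end contributes \<open>Si\<close> at infinity,
  which is pi/2, and the lower end \<open>Si 0 = 0\<close>; halving gives pi/4. For
  \<open>a = 0\<close> every term vanishes.\<close>

lemma integral_band_sin_tendsto:
  "(\<lambda>n. LINT k|band n. sin (k * a)) \<longlonglongrightarrow> pi / 4 * sgn a"
proof (cases "a = 0")
  case False
  have "filterlim (\<lambda>n. real (Suc n) * \<bar>a\<bar>) at_top sequentially"
    using False by real_asymp
  then have 1: "(\<lambda>n. Si (real (Suc n) * \<bar>a\<bar>)) \<longlonglongrightarrow> pi / 2"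
    by (rule filterlim_compose[OF Si_at_top])
  have "(\<lambda>n. 1 / real (Suc n) * \<bar>a\<bar>) \<longlonglongrightarrow> 0"
    by real_asymp
  then have "(\<lambda>n. Si (1 / real (Suc n) * \<bar>a\<bar>)) \<longlonglongrightarrow> Si 0"
    by (rule isCont_tendsto_compose[OF isCont_Si])
  moreover have "Si 0 = 0" using Si_neg[of 0] by simp
  ultimately have "(\<lambda>n. sgn a * (Si (real (Suc n) * \<bar>a\<bar>) - Si (1 / real (Suc n) * \<bar>a\<bar>)) / 2)
      \<longlonglongrightarrow> sgn a * (pi / 2 - 0) / 2"
    using 1 by (intro tendsto_intros) auto
  then show ?thesis
    unfolding integral_band_sin by (simp add: mult.commute)
qed simp

section \<open>Oscillatory integrals and their squared moduli\<close>

lemma (in pair_sigma_finite)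
  fixes F :: "'a \<Rightarrow> complex" and G :: "'b \<Rightarrow> complex"
  assumes F: "integrable M1 F" and G: "integrable M2 G"
  shows integrable_product_mult: "integrable (M1 \<Otimes>\<^sub>M M2) (\<lambda>w. F (fst w) * G (snd w))"
    and integral_product_mult:
      "(LINT w|(M1 \<Otimes>\<^sub>M M2). F (fst w) * G (snd w)) = (LINT y|M1. F y) * (LINT z|M2. G z)"
proof -
  have [measurable]: "F \<in> borel_measurable M1" "G \<in> borel_measurable M2" using F G by auto
  show int: "integrable (M1 \<Otimes>\<^sub>M M2) (\<lambda>w. F (fst w) * G (snd w))"
  proof (rule Fubini_integrable)
    show "integrable M1 (\<lambda>x. LINT y|M2. norm (F (fst (x, y)) * G (snd (x, y))))"
      using F by (simp add: norm_mult)
  qed (use G in auto)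
  show "(LINT w|(M1 \<Otimes>\<^sub>M M2). F (fst w) * G (snd w)) = (LINT y|M1. F y) * (LINT z|M2. G z)"
    using integral_fst'[OF int] by simp
qed

text \<open>Up to the factor 1/sqrt(2 pi) this is \<open>U_op\<close> when \<open>f\<close> is a
  position space function, and the Fourier transform when \<open>x\<close> is the identity. One
  notion thus covers both the given coordinates and the trivial ones.\<close>

definition osc :: "(real \<Rightarrow> real) \<Rightarrow> (real \<Rightarrow> complex) \<Rightarrow> real \<Rightarrow> complex" where
  "osc x f k = (LINT y|lborel. cis (- (k * x y)) * f y)"

lemma borel_measurable_osc [measurable]:
  assumes [measurable]: "x \<in> borel_measurable borel" "f \<in> borel_measurable borel"
  shows "osc x f \<in> borel_measurable borel"
  unfolding osc_def cis_conv_exp by measurable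

lemma norm_osc_le:
  assumes "integrable lborel f" and [measurable]: "x \<in> borel_measurable borel"
  shows "cmod (osc x f k) \<le> (LINT y|lborel. cmod (f y))"
proof -
  have "cmod (osc x f k) \<le> (LINT y|lborel. cmod (cis (- (k * x y)) * f y))"
    unfolding osc_def by (rule integral_norm_bound)
  then show ?thesis by (simp add: norm_mult)
qed

lemma integrable_cis_mult:
  assumes f: "integrable M f" and [measurable]: "x \<in> borel_measurable M"
  shows "integrable M (\<lambda>y. cis (x y) * f y)"
proof (rule Bochner_Integration.integrable_bound[OF f])
  have [measurable]: "f \<in> borel_measurable M" using f by auto
  show "(\<lambda>y. cis (x y) * f y) \<in> borel_measurable M"
    unfolding cis_conv_exp by measurable
qed (simp add: norm_mult)

text \<open>The squared modulus is the integral over \<open>y\<close> times the conjugate integral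
  over \<open>z\<close>; as a double integral its two phases merge into one depending only on
  \<open>x(y) - x(z)\<close>.\<close>

lemma osc_norm_sq:
  assumes f: "integrable lborel f" and [measurable]: "x \<in> borel_measurable borel"
  shows "integrable (lborel \<Otimes>\<^sub>M lborel)
      (\<lambda>w. cis (- (k * (x (fst w) - x (snd w)))) * (f (fst w) * cnj (f (snd w))))"
    and "complex_of_real ((cmod (osc x f k))\<^sup>2) = (LINT w|(lborel \<Otimes>\<^sub>M lborel).
      cis (- (k * (x (fst w) - x (snd w)))) * (f (fst w) * cnj (f (snd w))))"
proof -
  let ?F = "\<lambda>y. cis (- (k * x y)) * f y"
  have F: "integrable lborel ?F" using f by (intro integrable_cis_mult) auto
  have eq: "?F (fst w) * cnj (?F (snd w))
      = cis (- (k * (x (fst w) - x (snd w)))) * (f (fst w) * cnj (f (snd w)))" for w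
  proof -
    have "cis (- (k * x (fst w))) * cnj (cis (- (k * x (snd w))))
        = cis (- (k * (x (fst w) - x (snd w))))"
      by (simp add: cis_cnj cis_mult algebra_simps)
    then show ?thesis by (simp add: mult.assoc mult.left_commute)
  qed
  have cF: "integrable lborel (\<lambda>y. cnj (?F y))"
    using F by (rule integrable_cnj)
  show "integrable (lborel \<Otimes>\<^sub>M lborel)
      (\<lambda>w. cis (- (k * (x (fst w) - x (snd w)))) * (f (fst w) * cnj (f (snd w))))"
    using lborel_pair.integrable_product_mult[OF F cF] unfolding eq .
  show "complex_of_real ((cmod (osc x f k))\<^sup>2) = (LINT w|(lborel \<Otimes>\<^sub>M lborel).
      cis (- (k * (x (fst w) - x (snd w)))) * (f (fst w) * cnj (f (snd w))))"
    using lborel_pair.integral_product_mult[OF F cF]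
    by (simp only: eq complex_norm_square osc_def Bochner_Integration.integral_cnj)
qed

text \<open>Reversing the sign of \<open>k\<close> conjugates the phase, so the cosine parts cancel
  and only the sine survives.\<close>

lemma osc_norm_sq_diff:
  assumes f: "integrable lborel f" and x: "x \<in> borel_measurable borel"
  shows "complex_of_real ((cmod (osc x f k))\<^sup>2 - (cmod (osc x f (- k)))\<^sup>2)
    = (LINT w|(lborel \<Otimes>\<^sub>M lborel). complex_of_real (sin (k * (x (fst w) - x (snd w))))
        * (- 2 * \<i> * (f (fst w) * cnj (f (snd w)))))"
proof -
  have "cis (- t) * h - cis (- (- t)) * h = complex_of_real (sin t) * (- 2 * \<i> * h)" for t h
    by (simp add: complex_eq_iff algebra_simps)
  from this[where t = "k * (x (fst w) - x (snd w))" for w, symmetric]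
  show ?thesis
    unfolding of_real_diff osc_norm_sq(2)[OF f x]
    by (subst Bochner_Integration.integral_diff[symmetric])
      (use osc_norm_sq(1)[OF f x, of k] osc_norm_sq(1)[OF f x, of "- k"] in auto)
qed

text \<open>Fubini moves the band integral inside, where it acts on the sine alone; dominated
  convergence over the pairs (y, z) then replaces it by its limit.\<close>

lemma integral_band_osc_tendsto:
  assumes f: "integrable lborel f" and x [measurable]: "x \<in> borel_measurable borel"
  shows "(\<lambda>n. LINT k|band n. complex_of_real ((cmod (osc x f k))\<^sup>2 - (cmod (osc x f (- k)))\<^sup>2))
    \<longlonglongrightarrow> (LINT w|(lborel \<Otimes>\<^sub>M lborel). complex_of_real (pi / 4 * sgn (x (fst w) - x (snd w)))
        * (- 2 * \<i> * (f (fst w) * cnj (f (snd w)))))"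
proof -
  let ?P = "lborel \<Otimes>\<^sub>M lborel :: (real \<times> real) measure"
  define h where "h w = - 2 * \<i> * (f (fst w) * cnj (f (snd w)))" for w
  define d where "d w = x (fst w) - x (snd w)" for w
  define J where "J n a = (LINT k|band n. sin (k * a))" for n a
  have [measurable]: "d \<in> borel_measurable ?P" unfolding d_def by measurable
  have h: "integrable ?P h"
    unfolding h_def using lborel_pair.integrable_product_mult[of f "\<lambda>y. cnj (f y)"] f by simp
  then have [measurable]: "h \<in> borel_measurable ?P" by auto
  have swap: "(LINT k|band n. complex_of_real ((cmod (osc x f k))\<^sup>2 - (cmod (osc x f (- k)))\<^sup>2))
      = (LINT w|?P. complex_of_real (J n (d w)) * h w)" for n
  proof -
    interpret B: finite_measure "band n" by (rule finite_measure_band)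
    interpret B: pair_sigma_finite "band n" ?P
      unfolding lborel_prod ..
    \<comment> \<open>Since the band has finite mass, the constant 1 times \<open>h\<close> is
      integrable on the product and dominates the sine times \<open>h\<close>.\<close>
    have 1: "integrable (band n \<Otimes>\<^sub>M ?P) (\<lambda>v. 1 * h (snd v))"
      by (rule B.integrable_product_mult[OF _ h]) simp
    have "integrable (band n \<Otimes>\<^sub>M ?P) (\<lambda>v. complex_of_real (sin (fst v * d (snd v))) * h (snd v))"
      by (rule Bochner_Integration.integrable_bound[OF 1])
        (auto simp: norm_mult intro!: mult_left_le_one_le)
    then have "integrable (band n \<Otimes>\<^sub>M ?P) (\<lambda>(k, w). complex_of_real (sin (k * d w)) * h w)"
      by (simp add: case_prod_beta')
    from B.Fubini_integral[OF this]
    have "(LINT k|band n. LINT w|?P. complex_of_real (sin (k * d w)) * h w)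
        = (LINT w|?P. LINT k|band n. complex_of_real (sin (k * d w)) * h w)" by simp
    also have "\<dots> = (LINT w|?P. complex_of_real (J n (d w)) * h w)"
      unfolding J_def by simp
    finally show ?thesis
      unfolding osc_norm_sq_diff[OF f x] h_def d_def .
  qed
  obtain C where C: "\<And>n a. \<bar>J n a\<bar> \<le> C"
    unfolding J_def using integral_band_sin_bounded by blast
  have Jm [measurable]: "J n \<in> borel_measurable borel" for n
    unfolding J_def integral_band_sin by measurable
  have "(\<lambda>n. LINT w|?P. complex_of_real (J n (d w)) * h w)
      \<longlonglongrightarrow> (LINT w|?P. complex_of_real (pi / 4 * sgn (d w)) * h w)"
  proof (rule integral_dominated_convergence)
    show "integrable ?P (\<lambda>w. C * norm (h w))" using h by simp
    show "AE w in ?P. (\<lambda>n. complex_of_real (J n (d w)) * h w)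
        \<longlonglongrightarrow> complex_of_real (pi / 4 * sgn (d w)) * h w"
      unfolding J_def by (intro AE_I2 tendsto_mult tendsto_of_real integral_band_sin_tendsto tendsto_const)
    show "AE w in ?P. norm (complex_of_real (J n (d w)) * h w) \<le> C * norm (h w)" for n
      using C by (auto simp: norm_mult intro!: mult_right_mono)
  qed auto
  then show ?thesis
    unfolding swap h_def d_def .
qed

section \<open>Passing from the bands to the half-line\<close>

text \<open>On each band both integrals are finite and may be subtracted. In the limit they may be
  infinite, hence the additive form of the conclusion.\<close>

lemma nn_integral_mom_diff:
  fixes p q :: "real \<Rightarrow> real"
  assumes [measurable]: "p \<in> borel_measurable borel" "q \<in> borel_measurable borel"
    and nonneg: "\<And>k. 0 \<le> p k" "\<And>k. 0 \<le> q k" and bdd: "\<And>k. p k \<le> C" "\<And>k. q k \<le> C"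
    and lim: "(\<lambda>n. LINT k|band n. p k - q k) \<longlonglongrightarrow> c" and c: "0 < c"
  shows "(\<integral>\<^sup>+ k. p k \<partial>mom) = ennreal c + (\<integral>\<^sup>+ k. q k \<partial>mom)"
proof -
  have int: "integrable (band n) p" "integrable (band n) q" for n
  proof -
    interpret finite_measure "band n" by (rule finite_measure_band)
    show "integrable (band n) p" "integrable (band n) q"
      using nonneg bdd by (auto intro!: integrable_const_bound[where B=C])
  qed
  have "(\<integral>\<^sup>+ k. p k \<partial>band n) = ennreal (LINT k|band n. p k - q k) + (\<integral>\<^sup>+ k. q k \<partial>band n)"
    if "0 < (LINT k|band n. p k - q k)" for n
    using that int[of n] nonneg
    by (simp add: nn_integral_eq_integral integral_nonneg ennreal_plus[symmetric] del: ennreal_plus)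
  \<comment> \<open>\<open>ennreal\<close> sends negative reals to 0, so the identity on a band is
    used only where the difference is positive; a positive limit makes this eventually true.\<close>
  moreover have "\<forall>\<^sub>F n in sequentially. 0 < (LINT k|band n. p k - q k)"
    using order_tendstoD(1)[OF lim c] .
  ultimately have ev: "\<forall>\<^sub>F n in sequentially.
      ennreal (LINT k|band n. p k - q k) + (\<integral>\<^sup>+ k. q k \<partial>band n) = (\<integral>\<^sup>+ k. p k \<partial>band n)"
    by (auto elim: eventually_mono)
  have "(\<lambda>n. ennreal (LINT k|band n. p k - q k) + (\<integral>\<^sup>+ k. q k \<partial>band n))
      \<longlonglongrightarrow> ennreal c + (\<integral>\<^sup>+ k. q k \<partial>mom)"
    by (intro tendsto_add tendsto_ennrealI lim nn_integral_band_tendsto) measurable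
  then have "(\<lambda>n. \<integral>\<^sup>+ k. p k \<partial>band n) \<longlonglongrightarrow> ennreal c + (\<integral>\<^sup>+ k. q k \<partial>mom)"
    using ev by (rule Lim_transform_eventually)
  moreover have "(\<lambda>n. \<integral>\<^sup>+ k. p k \<partial>band n) \<longlonglongrightarrow> (\<integral>\<^sup>+ k. p k \<partial>mom)"
    by (rule nn_integral_band_tendsto) measurable
  ultimately show ?thesis by (rule LIMSEQ_unique[symmetric])
qed

text \<open>This evaluates the limit for trivial coordinates, where the negative frequency part
  \<open>q\<close> vanishes almost everywhere on the half-line and only the norm of \<open>p\<close>
  remains.\<close>

lemma band_tendsto_of_mom:
  fixes p q :: "real \<Rightarrow> real"
  assumes [measurable]: "p \<in> borel_measurable borel" "q \<in> borel_measurable borel"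
    and nonneg: "\<And>k. 0 \<le> p k" and mom: "(\<integral>\<^sup>+ k. p k \<partial>mom) = ennreal c" and c: "0 \<le> c"
    and q: "AE k in lborel. k > 0 \<longrightarrow> q k = 0"
  shows "(\<lambda>n. LINT k|band n. p k - q k) \<longlonglongrightarrow> c"
proof -
  have eq: "(LINT k|band n. p k - q k) = enn2real (\<integral>\<^sup>+ k. p k \<partial>band n)" for n
  proof -
    have "AE k in band n. p k - q k = p k"
      unfolding band_def using q
      by (subst AE_density) (auto elim!: eventually_mono simp: indicator_def band_pos simp del: of_nat_Suc)
    then have "(LINT k|band n. p k - q k) = (LINT k|band n. p k)"
      by (intro integral_cong_AE) auto
    also have "\<dots> = enn2real (\<integral>\<^sup>+ k. p k \<partial>band n)"
      using nonneg by (intro integral_eq_nn_integral) auto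
    finally show ?thesis .
  qed
  have "(\<lambda>n. \<integral>\<^sup>+ k. p k \<partial>band n) \<longlonglongrightarrow> ennreal c"
    unfolding mom[symmetric] by (rule nn_integral_band_tendsto) measurable
  then show ?thesis
    unfolding eq using c tendsto_enn2real by blast
qed

section \<open>The norm identity for A and B\<close>

lemma U_op_eq_osc: "U_op x u k = complex_of_real (1 / sqrt (2 * pi)) * osc x (pos_fun u) k"
  by (simp add: U_op_def osc_def cis_conv_exp)

lemma fourier_eq_osc: "fourier f k = complex_of_real (1 / sqrt (2 * pi)) * osc (\<lambda>y. y) f k"
  by (simp add: fourier_def osc_def cis_conv_exp mult.commute)

text \<open>The coordinate map enters the limit only through the sign of \<open>x(y) - x(z)\<close>,
  which is the same for all strictly increasing maps. The identity map therefore determines the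
  value.\<close>

lemma A_op_square_eq:
  assumes u: "normalized u" "has_integrable_pos_fun u" and x: "strict_mono x"
  shows "sqnorm (A_op x u) = 1 + sqnorm (B_op x u)"
proof -
  let ?f = "pos_fun u" and ?c = "1 / sqrt (2 * pi)"
  have f: "integrable lborel ?f" using u(2) by (simp add: has_integrable_pos_fun_def)
  then have [measurable]: "?f \<in> borel_measurable borel" by auto
  have [measurable]: "x \<in> borel_measurable borel"
    using x by (intro borel_measurable_mono strict_mono_mono)
  define q where "q z k = (cmod (complex_of_real ?c * osc z ?f k))\<^sup>2" for z k
  have qm [measurable]: "q z \<in> borel_measurable borel" if [measurable]: "z \<in> borel_measurable borel" for z
    unfolding q_def by measurable
  have q_eq: "q z k = ?c\<^sup>2 * (cmod (osc z ?f k))\<^sup>2" for z k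
    by (simp add: q_def norm_mult norm_divide power_mult_distrib power_divide)
  have bdd: "q x k \<le> ?c\<^sup>2 * (LINT y|lborel. cmod (?f y))\<^sup>2" for k
    unfolding q_eq using norm_osc_le[OF f, of x k] by (intro mult_left_mono power_mono) auto
  \<comment> \<open>The common limit, written without a coordinate map. It is complex as an
    integral; that it is real emerges only from \<open>L = 1\<close>.\<close>
  define L where "L = complex_of_real (?c\<^sup>2) * (LINT w|(lborel \<Otimes>\<^sub>M lborel).
      complex_of_real (pi / 4 * sgn (fst w - snd w)) * (- 2 * \<i> * (?f (fst w) * cnj (?f (snd w)))))"
  have lim: "(\<lambda>n. complex_of_real (LINT k|band n. q z k - q z (- k))) \<longlonglongrightarrow> L"
    if z: "strict_mono z" for z
  proof -
    have zm: "z \<in> borel_measurable borel"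
      using z by (intro borel_measurable_mono strict_mono_mono)
    have "sgn (z a - z b) = sgn (a - b)" for a b
      using strict_mono_less[OF z, of a b] strict_mono_less[OF z, of b a] by (auto simp: sgn_if)
    then have "(\<lambda>n. complex_of_real (?c\<^sup>2) *
        (LINT k|band n. complex_of_real ((cmod (osc z ?f k))\<^sup>2 - (cmod (osc z ?f (- k)))\<^sup>2))) \<longlonglongrightarrow> L"
      unfolding L_def using integral_band_osc_tendsto[OF f zm] by (intro tendsto_mult_left) simp
    moreover have "complex_of_real (?c\<^sup>2) *
        (LINT k|band n. complex_of_real ((cmod (osc z ?f k))\<^sup>2 - (cmod (osc z ?f (- k)))\<^sup>2))
        = complex_of_real (LINT k|band n. q z k - q z (- k))" for n
      unfolding q_eq right_diff_distrib[symmetric] integral_mult_right_zero integral_complex_of_real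
      by simp
    ultimately show ?thesis by simp
  qed
  have inv: "AE p in lborel. ext0 u p = fourier ?f p"
    using u(2) by (simp add: has_integrable_pos_fun_def)
  \<comment> \<open>Reflection preserves \<open>lborel\<close>, so inversion also holds almost
    everywhere at \<open>- p\<close>. As \<open>ext0\<close> vanishes at negative arguments, trivial
    coordinates create no particles.\<close>
  have "AE p in lborel. ext0 u (- p) = fourier ?f (- p)"
  proof -
    have "AE p in distr lborel borel uminus. ext0 u p = fourier ?f p"
      using inv by (simp only: lborel_distr_uminus)
    then show ?thesis
      by (rule AE_distrD[rotated]) measurable
  qed
  then have neg: "AE k in lborel. k > 0 \<longrightarrow> q (\<lambda>y. y) (- k) = 0"
    by eventually_elim (auto simp: q_def fourier_eq_osc ext0_def)
  have "(\<integral>\<^sup>+ k. q (\<lambda>y. y) k \<partial>mom) = sqnorm u"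
    unfolding sqnorm_def q_def fourier_eq_osc[symmetric]
    by (intro nn_integral_cong_AE AE_momI)
      (use inv in eventually_elim, auto simp: ext0_def)
  also have "\<dots> = ennreal 1" using u(1) by (simp add: normalized_def)
  finally have "(\<lambda>n. LINT k|band n. q (\<lambda>y. y) k - q (\<lambda>y. y) (- k)) \<longlonglongrightarrow> 1"
    using neg by (intro band_tendsto_of_mom) (auto simp: q_def)
  then have "(\<lambda>n. complex_of_real (LINT k|band n. q (\<lambda>y. y) k - q (\<lambda>y. y) (- k)))
      \<longlonglongrightarrow> complex_of_real 1"
    by (rule tendsto_of_real)
  with lim[of "\<lambda>y. y"] have "L = complex_of_real 1"
    by (auto simp: strict_mono_def intro: LIMSEQ_unique)
  with lim[OF x] have "(\<lambda>n. LINT k|band n. q x k - q x (- k)) \<longlonglongrightarrow> 1"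
    by (simp only: tendsto_of_real_iff)
  \<comment> \<open>Only now is the limit split into the two norms, both of which may be
    infinite.\<close>
  then have "(\<integral>\<^sup>+ k. q x k \<partial>mom) = ennreal 1 + (\<integral>\<^sup>+ k. q x (- k) \<partial>mom)"
    by (intro nn_integral_mom_diff[where C = "?c\<^sup>2 * (LINT y|lborel. cmod (?f y))\<^sup>2"])
      (use bdd in \<open>auto simp: q_def\<close>)
  then show ?thesis
    by (simp add: sqnorm_def A_op_def B_op_def U_op_eq_osc q_def)
qed

section \<open>Inner products\<close>

text \<open>Follows from the inequality for nonnegative integrals, so infinite norms are allowed. If
  the product is not integrable, the Bochner integral is 0 and the first estimate is
  trivial.\<close>

lemma inner_mom_Cauchy_Schwarz:
  assumes [measurable]: "u \<in> borel_measurable mom" "v \<in> borel_measurable mom"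
  shows "ennreal ((cmod (inner_mom u v))\<^sup>2) \<le> sqnorm u * sqnorm v"
proof -
  have "ennreal (cmod (inner_mom u v)) \<le> (\<integral>\<^sup>+ k. ennreal (cmod (cnj (u k) * v k)) \<partial>mom)"
    unfolding inner_mom_def
    by (cases "integrable mom (\<lambda>k. cnj (u k) * v k)")
      (auto intro: integral_norm_bound_ennreal simp: not_integrable_integral_eq)
  also have "\<dots> = (\<integral>\<^sup>+ k. ennreal (cmod (u k)) * ennreal (cmod (v k)) \<partial>mom)"
    by (simp add: norm_mult ennreal_mult)
  finally have "(ennreal (cmod (inner_mom u v)))\<^sup>2
      \<le> (\<integral>\<^sup>+ k. ennreal (cmod (u k)) * ennreal (cmod (v k)) \<partial>mom)\<^sup>2"
    by (intro power_mono) auto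
  also have "\<dots> \<le> (\<integral>\<^sup>+ k. (ennreal (cmod (u k)))\<^sup>2 \<partial>mom) * (\<integral>\<^sup>+ k. (ennreal (cmod (v k)))\<^sup>2 \<partial>mom)"
    by (rule Cauchy_Schwarz_nn_integral) measurable
  finally show ?thesis
    by (simp add: sqnorm_def ennreal_power)
qed

lemma inner_mom_self:
  assumes "u \<in> borel_measurable mom" "sqnorm u < \<infinity>"
  shows "inner_mom u u = complex_of_real (enn2real (sqnorm u))"
proof -
  have "inner_mom u u = (LINT k|mom. complex_of_real ((cmod (u k))\<^sup>2))"
    unfolding inner_mom_def complex_norm_square by (simp add: mult.commute)
  also have "\<dots> = complex_of_real (enn2real (sqnorm u))"
    unfolding integral_complex_of_real sqnorm_def
    using assms(1) by (subst integral_eq_nn_integral) auto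
  finally show ?thesis .
qed

section \<open>Bounds on the particle numbers\<close>

lemma coord_transformation_strict_mono:
  assumes "coord_transformation x"
  shows "strict_mono x"
proof (rule strict_monoI)
  fix a b :: real assume "a < b"
  have "(x has_real_derivative deriv x y) (at y)" "deriv x y > 0" for y
    using assms DERIV_deriv_iff_field_differentiable
    unfolding coord_transformation_def by (metis funpow_0)+
  then show "x a < x b" by (intro DERIV_pos_imp_increasing[OF \<open>a < b\<close>]) blast
qed

theorem theorem9:
  fixes ft gt :: "real \<Rightarrow> complex" and x :: "real \<Rightarrow> real"
  assumes "ft \<in> L2_mom" and "gt \<in> L2_mom"
    and "normalized ft" and "normalized gt"
    and "has_integrable_pos_fun ft" and "has_integrable_pos_fun gt"
    and "coord_transformation x"
  shows "N_spont x ft \<le> N_stim x gt ft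
    \<and> N_stim x gt ft \<le> 1 + 3 * N_spont x ft
    \<and> (sqnorm (A_op x ft) < \<infinity> \<longrightarrow> 1 + N_spont x ft \<le> N_stim x (g_cl x ft) ft)"
proof (intro conjI impI)
  let ?N = "N_spont x ft" and ?A = "A_op x ft" and ?B = "B_op x ft"
  have x: "strict_mono x" by (rule coord_transformation_strict_mono) fact
  then have [measurable]: "x \<in> borel_measurable borel"
    by (intro borel_measurable_mono strict_mono_mono)
  have "pos_fun ft \<in> borel_measurable lborel"
    using assms(5) unfolding has_integrable_pos_fun_def by (blast dest: borel_measurable_integrable)
  then have [measurable]: "pos_fun ft \<in> borel_measurable borel" by simp
  have AB_borel: "?A \<in> borel_measurable borel" "?B \<in> borel_measurable borel"
    unfolding A_op_def B_op_def U_op_eq_osc by measurable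
  have borel_mom: "u \<in> borel_measurable mom" if "u \<in> borel_measurable borel" for u :: "real \<Rightarrow> complex"
    using that by (simp add: mom_def measurable_restrict_space1)
  have AB: "?A \<in> borel_measurable mom" "?B \<in> borel_measurable mom"
    using AB_borel by (auto intro: borel_mom)
  have g: "gt \<in> borel_measurable mom" using assms(2) by (simp add: L2_mom_def)
  have cg: "(\<lambda>k. cnj (gt k)) \<in> borel_measurable mom"
    using g by (rule measurable_compose)
      (intro borel_measurable_continuous_onI continuous_on_cnj continuous_on_id)
  have sqA: "sqnorm ?A = 1 + ?N"
    unfolding N_spont_def by (rule A_op_square_eq) (use assms x in auto)
  show "?N \<le> N_stim x gt ft" by (simp add: N_stim_def add.assoc)
  show "N_stim x gt ft \<le> 1 + 3 * ?N"
  proof -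
    have g1: "sqnorm gt = 1" "sqnorm (\<lambda>k. cnj (gt k)) = 1"
      using assms(4) by (simp_all add: normalized_def sqnorm_def)
    \<comment> \<open>\<open>gt\<close> and its conjugate have norm 1, so the two overlaps are at
      most \<open>1 + ?N\<close> and \<open>?N\<close>.\<close>
    have "N_stim x gt ft \<le> ?N + sqnorm gt * sqnorm ?A + sqnorm (\<lambda>k. cnj (gt k)) * sqnorm ?B"
      unfolding N_stim_def using AB g cg
      by (intro add_mono inner_mom_Cauchy_Schwarz order_refl)
    also have "\<dots> = ?N + (1 + ?N) + ?N"
      unfolding g1 sqA by (simp add: N_spont_def)
    also have "\<dots> = 1 + 3 * ?N"
      using distrib_right[of 1 2 ?N] mult_2[of ?N] by (simp add: ac_simps)
    finally show ?thesis .
  qed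
  assume fin: "sqnorm ?A < \<infinity>"
  define a where "a = enn2real (sqnorm ?A)"
  have a: "sqnorm ?A = ennreal a" "0 \<le> a" using fin by (auto simp: a_def)
  \<comment> \<open>This makes the normalization of \<open>g_cl\<close> a genuine division by a
    nonzero norm.\<close>
  have "1 \<le> ennreal a" using sqA a by simp
  then have "0 < a" by (simp add: a)
  \<comment> \<open>The overlap of A f with its own normalization is its norm, whose square
    \<open>1 + ?N\<close> is already the bound; the other terms of \<open>N_stim\<close> are
    nonnegative.\<close>
  have "inner_mom (g_cl x ft) ?A = complex_of_real (inverse (sqrt a)) * inner_mom ?A ?A"
    unfolding inner_mom_def g_cl_def L2norm_def a_def by (simp add: mult.assoc)
  also have "\<dots> = complex_of_real (sqrt a)"
    unfolding inner_mom_self[OF AB(1) fin] a_def[symmetric] of_real_mult[symmetric]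
    using real_div_sqrt[of a] a by (simp only: divide_inverse mult.commute)
  finally have "ennreal ((cmod (inner_mom (g_cl x ft) ?A))\<^sup>2) = 1 + ?N"
    using \<open>0 < a\<close> sqA a by simp
  then show "1 + ?N \<le> N_stim x (g_cl x ft) ft"
    by (simp add: N_stim_def add.assoc add_increasing)
qed

end
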